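(* Let $M$ be a principal $\mathbb{S}^1$-bundle over the long ray $\mathbb{L}_+$, with bundle map $\pi:M\to\mathbb{L}_+$ and homeomorphisms $f_\alpha:(0,\alpha+1)\times\mathbb{S}^1\to\pi^{-1}((0,\alpha+1))$ satisfying $\pi(f_\alpha(\langle p,\phi\rangle))=p$ for each $\alpha\in\omega_1$. Let $F\subset M$ be club. Then there is a club $C\subset\omega_1$ such that exactly one of the two alternatives below holds. (a) $F\supset\pi^{-1}(C)$. (b) There is $n\in\omega$ and a club $E\subset F$ such that $|E\cap M_\alpha|=n$ for each $\alpha\in C$, and if $x\in M_\alpha\cap E$, then $M_\alpha\cap E=\{x+\frac{2\pi\cdot k}{n}: k=0,\dots,n-1\}$.
   Context: The long ray $\mathbb{L}_+$ is $\omega_1\times[0,1)$ with the lexicographic order topology and the smallest point removed; its points are written $\alpha+r$ with $\alpha\in\omega_1$, $r\in[0,1)$, and $\omega_1$ is seen as a subset of $\mathbb{L}_+$ (the points with $r=0$; the ordinal $0$ corresponds to the removed point and is disregarded). Intervals $(0,\alpha+1)$ are taken in $\mathbb{L}_+$. $\mathbb{S}^1$ is the group of reals modulo $2\pi$. A principal $\mathbb{S}^1$-bundle $\pi:M\to\mathbb{L}_+$ is a continuous map such that each $p\in\mathbb{L}_+$ has an open neighborhood $U$ with a fiber-preserving homeomorphism $U\times\mathbb{S}^1\to\pi^{-1}(U)$, together with a continuous action of $\mathbb{S}^1$ on $M$ which leaves each fiber $M_p=\pi^{-1}(\{p\})$ invariant and is free and transitive on each fiber. For $x\in M$ and an angle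 $\theta$, $x+\theta\in M_{\pi(x)}$ denotes the image of $x$ under the action of $\theta$, i.e. the point of the same fiber that is $\theta$ radians from $x$ in the positive direction (angles are added modulo $2\pi$). A subset $A\subset M$ is unbounded if $\pi(A)$ is unbounded in $\mathbb{L}_+$; club means closed and unbounded (in $M$, respectively in $\omega_1$).
   Formalization: Alternative (b) additionally requires that no fiber M_α with α∈C is contained in F; without this, "exactly one" fails, e.g. for F=M the trivial bundle, where (a) and (b) (n=1, E the zero section) both hold for every C. *)

theory Defs
  imports "HOL-Analysis.Analysis"
begin

section \<open>The ordinal \<open>\<omega>\<^sub>1\<close>\<close>

text \<open>
  \<open>cardSuc natLeq\<close> is the least cardinal above \<open>\<aleph>\<^sub>0\<close>, given as a well-order all of whose proper
  initial segments are strictly smaller; its field, in this order, is a copy of \<open>\<omega>\<^sub>1\<close>.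
\<close>

lemma cardSuc_natLeq: "Card_order (cardSuc natLeq)" "Well_order (cardSuc natLeq)"
  using cardSuc_Card_order[OF natLeq_Card_order] by (auto simp: card_order_on_def)

lemma infinite_Field_cardSuc_natLeq: "infinite (Field (cardSuc natLeq))"
  using cardSuc_finite[OF natLeq_Card_order] by (simp add: Field_natLeq)

typedef omega1 = "Field (cardSuc natLeq)"
  using infinite_Field_cardSuc_natLeq by (metis ex_in_conv finite.emptyI)

instantiation omega1 :: linorder
begin

definition less_eq_omega1 :: "omega1 \<Rightarrow> omega1 \<Rightarrow> bool" where
  "\<alpha> \<le> \<beta> \<longleftrightarrow> (Rep_omega1 \<alpha>, Rep_omega1 \<beta>) \<in> cardSuc natLeq"

definition less_omega1 :: "omega1 \<Rightarrow> omega1 \<Rightarrow> bool" where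
  "\<alpha> < \<beta> \<longleftrightarrow> \<alpha> \<le> \<beta> \<and> \<alpha> \<noteq> \<beta>" for \<alpha> \<beta> :: omega1

instance
proof -
  let ?r = "cardSuc natLeq"
  have "Linear_order ?r"
    using cardSuc_natLeq(2) by (auto simp: well_order_on_def)
  then have refl: "Refl ?r" and trans: "trans ?r" and antisym: "antisym ?r" and total: "Total ?r"
    by (auto simp: linear_order_on_def partial_order_on_def preorder_on_def)
  have le_refl: "\<alpha> \<le> \<alpha>" for \<alpha> :: omega1
    using refl Rep_omega1 by (auto simp: less_eq_omega1_def refl_on_def)
  have le_antisym: "\<alpha> = \<beta>" if "\<alpha> \<le> \<beta>" "\<beta> \<le> \<alpha>" for \<alpha> \<beta> :: omega1
    using that antisym unfolding less_eq_omega1_def by (metis antisymD Rep_omega1_inject)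
  show "OFCLASS(omega1, linorder_class)"
  proof
    fix \<alpha> \<beta> \<gamma> :: omega1
    show "\<alpha> < \<beta> \<longleftrightarrow> \<alpha> \<le> \<beta> \<and> \<not> \<beta> \<le> \<alpha>"
      using le_antisym le_refl by (auto simp: less_omega1_def)
    show "\<alpha> \<le> \<alpha>" by (rule le_refl)
    show "\<alpha> \<le> \<beta> \<Longrightarrow> \<beta> \<le> \<gamma> \<Longrightarrow> \<alpha> \<le> \<gamma>"
      using trans unfolding less_eq_omega1_def by (meson transE)
    show "\<alpha> \<le> \<beta> \<Longrightarrow> \<beta> \<le> \<alpha> \<Longrightarrow> \<alpha> = \<beta>" by (rule le_antisym)
    show "\<alpha> \<le> \<beta> \<or> \<beta> \<le> \<alpha>"
      using total le_refl Rep_omega1 unfolding less_eq_omega1_def total_on_def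
      by (metis Rep_omega1_inject)
  qed
qed

end

instance omega1 :: wellorder
proof
  fix P :: "omega1 \<Rightarrow> bool" and \<alpha> :: omega1
  assume step: "\<And>\<alpha>. (\<And>\<beta>. \<beta> < \<alpha> \<Longrightarrow> P \<beta>) \<Longrightarrow> P \<alpha>"
  have "wf (cardSuc natLeq - Id)"
    using cardSuc_natLeq(2) by (auto simp: well_order_on_def)
  then have "wf (inv_image (cardSuc natLeq - Id) Rep_omega1)"
    by (rule wf_inv_image)
  then show "P \<alpha>"
  proof (induction \<alpha> rule: wf_induct_rule)
    case (less \<alpha>)
    show ?case
      by (rule step, rule less) (auto simp: less_omega1_def less_eq_omega1_def Rep_omega1_inject)
  qed
qed

instantiation omega1 :: order_bot
begin

definition bot_omega1 :: omega1 where
  "bot = (LEAST \<alpha>::omega1. True)"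

instance
  by standard (simp add: bot_omega1_def Least_le)

end

instantiation omega1 :: linorder_topology
begin

definition open_omega1 :: "omega1 set \<Rightarrow> bool" where
  "open_omega1 = generate_topology (range (\<lambda>a. {..< a}) \<union> range (\<lambda>a. {a <..}))"

instance
  by standard (rule open_omega1_def)

end

lemma countable_iff_card_of_le_natLeq: "countable A \<longleftrightarrow> (card_of A, natLeq) \<in> ordLeq"
proof -
  have "countable A \<longleftrightarrow> (card_of A, card_of (UNIV :: nat set)) \<in> ordLeq"
    by (auto simp: countable_def simp flip: card_of_ordLeq)
  also have "\<dots> \<longleftrightarrow> (card_of A, natLeq) \<in> ordLeq"
    using card_of_nat ordLeq_ordIso_trans ordIso_symmetric by blast
  finally show ?thesis .
qed

lemma countable_lessThan_omega1: "countable {..<\<alpha>::omega1}"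
proof -
  include cardinal_syntax
  let ?r = "cardSuc natLeq"
  have "|underS ?r (Rep_omega1 \<alpha>)| <o ?r"
    using card_of_underS[OF cardSuc_natLeq(1) Rep_omega1] .
  then have "|underS ?r (Rep_omega1 \<alpha>)| \<le>o natLeq"
    using cardSuc_ordLeq_ordLess[OF natLeq_Card_order card_of_Card_order] by blast
  then have "countable (underS ?r (Rep_omega1 \<alpha>))"
    by (simp add: countable_iff_card_of_le_natLeq)
  moreover have "Rep_omega1 ` {..<\<alpha>} \<subseteq> underS ?r (Rep_omega1 \<alpha>)"
    by (auto simp: underS_def less_omega1_def less_eq_omega1_def Rep_omega1_inject)
  ultimately show ?thesis
    by (meson Rep_omega1_inject countable_image_inj_on countable_subset inj_onI)
qed

lemma uncountable_omega1: "uncountable (UNIV :: omega1 set)"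
proof
  include cardinal_syntax
  assume "countable (UNIV :: omega1 set)"
  then have "countable (Field (cardSuc natLeq))"
    by (metis countable_image type_definition.Rep_range type_definition_omega1)
  then have "|Field (cardSuc natLeq)| \<le>o natLeq"
    by (simp add: countable_iff_card_of_le_natLeq)
  then have "cardSuc natLeq \<le>o natLeq"
    using card_of_Field_ordIso[OF cardSuc_natLeq(1)] ordIso_ordLeq_trans ordIso_symmetric by blast
  then show False
    using cardSuc_greater[OF natLeq_Card_order] not_ordLess_ordLeq by blast
qed

instance omega1 :: no_top
proof
  fix \<alpha> :: omega1
  have "{..\<alpha>} = insert \<alpha> {..<\<alpha>}"
    by auto
  then have "countable {..\<alpha>}"
    by (simp add: countable_lessThan_omega1)
  then have "{..\<alpha>} \<noteq> UNIV"
    using uncountable_omega1 by auto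
  then show "\<exists>\<beta>. \<alpha> < \<beta>"
    by (auto simp: not_le)
qed

definition osuc :: "omega1 \<Rightarrow> omega1" where
  "osuc \<alpha> = (LEAST \<beta>. \<alpha> < \<beta>)"

lemma less_osuc: "\<alpha> < osuc \<alpha>"
  unfolding osuc_def by (rule LeastI_ex) (rule gt_ex)


section \<open>The long ray\<close>

typedef long_ray = "{(\<alpha> :: omega1, r :: real). 0 \<le> r \<and> r < 1 \<and> (\<alpha>, r) \<noteq> (bot, 0)}"
  by (intro exI[of _ "(bot, 1/2)"]) auto

instantiation long_ray :: linorder
begin

definition less_eq_long_ray :: "long_ray \<Rightarrow> long_ray \<Rightarrow> bool" where
  "p \<le> q \<longleftrightarrow> fst (Rep_long_ray p) < fst (Rep_long_ray q) \<or>
     fst (Rep_long_ray p) = fst (Rep_long_ray q) \<and> snd (Rep_long_ray p) \<le> snd (Rep_long_ray q)"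

definition less_long_ray :: "long_ray \<Rightarrow> long_ray \<Rightarrow> bool" where
  "p < q \<longleftrightarrow> p \<le> q \<and> \<not> q \<le> p" for p q :: long_ray

instance
proof
  fix p q s :: long_ray
  show "p < q \<longleftrightarrow> p \<le> q \<and> \<not> q \<le> p" by (rule less_long_ray_def)
  show "p \<le> p" by (simp add: less_eq_long_ray_def)
  show "p \<le> q \<Longrightarrow> q \<le> s \<Longrightarrow> p \<le> s" by (auto simp: less_eq_long_ray_def)
  show "p \<le> q \<Longrightarrow> q \<le> p \<Longrightarrow> p = q"
    by (auto simp: less_eq_long_ray_def simp flip: Rep_long_ray_inject intro: prod_eqI)
  show "p \<le> q \<or> q \<le> p" by (auto simp: less_eq_long_ray_def)
qed

end

instantiation long_ray :: linorder_topology
begin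

definition open_long_ray :: "long_ray set \<Rightarrow> bool" where
  "open_long_ray = generate_topology (range (\<lambda>a. {..< a}) \<union> range (\<lambda>a. {a <..}))"

instance
  by standard (rule open_long_ray_def)

end

text \<open>
  The embedding of \<open>\<omega>\<^sub>1\<close> into the long ray. It is meaningful only for nonzero ordinals, since
  \<open>bot + 0\<close> is the removed point.
\<close>

definition ray_of :: "omega1 \<Rightarrow> long_ray" where
  "ray_of \<alpha> = Abs_long_ray (\<alpha>, 0)"

lemma Rep_ray_of: "bot < \<alpha> \<Longrightarrow> Rep_long_ray (ray_of \<alpha>) = (\<alpha>, 0)"
  unfolding ray_of_def by (subst Abs_long_ray_inverse) auto


section \<open>The circle group\<close>

definition cong_2pi :: "real \<Rightarrow> real \<Rightarrow> bool" where
  "cong_2pi x y \<longleftrightarrow> (\<exists>k::int. x - y = 2 * pi * of_int k)"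

lemma cong_2pi_refl: "cong_2pi x x"
  unfolding cong_2pi_def by (rule exI[of _ 0]) simp

lemma cong_2pi_add:
  assumes "cong_2pi a b" "cong_2pi c d"
  shows "cong_2pi (a + c) (b + d)"
proof -
  obtain k l :: int where "a - b = 2 * pi * of_int k" "c - d = 2 * pi * of_int l"
    using assms by (auto simp: cong_2pi_def)
  then have "a + c - (b + d) = 2 * pi * of_int (k + l)"
    by (simp add: algebra_simps)
  then show ?thesis
    unfolding cong_2pi_def by (rule exI)
qed

lemma cong_2pi_minus:
  assumes "cong_2pi a b"
  shows "cong_2pi (- a) (- b)"
proof -
  obtain k :: int where "a - b = 2 * pi * of_int k"
    using assms by (auto simp: cong_2pi_def)
  then have "- a - - b = 2 * pi * of_int (- k)"
    by (simp add: algebra_simps)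
  then show ?thesis
    unfolding cong_2pi_def by (rule exI)
qed

lemma equivp_cong_2pi: "equivp cong_2pi"
proof (rule equivpI)
  show "reflp cong_2pi"
    by (rule reflpI) (rule cong_2pi_refl)
  show "symp cong_2pi"
  proof (rule sympI)
    fix x y assume "cong_2pi x y"
    from cong_2pi_add[OF cong_2pi_minus[OF this] cong_2pi_refl[of "x + y"]]
    show "cong_2pi y x" by simp
  qed
  show "transp cong_2pi"
  proof (rule transpI)
    fix x y z assume "cong_2pi x y" "cong_2pi y z"
    from cong_2pi_add[OF cong_2pi_add[OF this] cong_2pi_refl[of "- y"]]
    show "cong_2pi x z" by simp
  qed
qed

quotient_type circle = real / cong_2pi
  morphisms rep_circle angle
  by (rule equivp_cong_2pi)

instantiation circle :: ab_group_add
begin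

lift_definition zero_circle :: circle is 0 .

lift_definition plus_circle :: "circle \<Rightarrow> circle \<Rightarrow> circle" is "(+)"
  by (rule cong_2pi_add)

lift_definition uminus_circle :: "circle \<Rightarrow> circle" is uminus
  by (rule cong_2pi_minus)

lift_definition minus_circle :: "circle \<Rightarrow> circle \<Rightarrow> circle" is "(-)"
  by (metis add_uminus_conv_diff cong_2pi_add cong_2pi_minus)

instance
proof
  fix a b c :: circle
  show "a + b + c = a + (b + c)"
    by transfer (simp add: add.assoc cong_2pi_refl)
  show "a + b = b + a"
    by transfer (simp add: add.commute cong_2pi_refl)
  show "0 + a = a"
    by transfer (simp add: cong_2pi_refl)
  show "- a + a = 0"
    by transfer (simp add: cong_2pi_refl)
  show "a - b = a + - b"
    by transfer (simp add: cong_2pi_refl)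
qed

end

instantiation circle :: topological_space
begin

definition open_circle :: "circle set \<Rightarrow> bool" where
  "open_circle U \<longleftrightarrow> open (angle -` U)"

instance
proof
  show "open (UNIV :: circle set)"
    by (simp add: open_circle_def)
  show "open (S \<inter> T)" if "open S" "open T" for S T :: "circle set"
    using that by (auto simp: open_circle_def)
  show "open (\<Union>K)" if "\<forall>S\<in>K. open S" for K :: "circle set set"
    using that by (auto simp: open_circle_def vimage_Union)
qed

end


section \<open>Principal circle bundles\<close>

text \<open>
  The total space is the whole type \<open>'m\<close>. As in the source, the local trivialisations are only
  required to preserve fibres, not to be equivariant.
\<close>

locale principal_circle_bundle =
  fixes proj :: "'m::topological_space \<Rightarrow> long_ray"
    and act :: "'m \<Rightarrow> circle \<Rightarrow> 'm"
  assumes continuous_proj: "continuous_on UNIV proj"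
    and locally_trivial:
      "\<exists>U \<phi> \<psi>. open U \<and> p \<in> U \<and> homeomorphism (U \<times> (UNIV :: circle set)) (proj -` U) \<phi> \<psi> \<and>
         (\<forall>q\<in>U. \<forall>\<theta>. proj (\<phi> (q, \<theta>)) = q)"
    and continuous_act: "continuous_on UNIV (\<lambda>(x, \<theta>). act x \<theta>)"
    and act_zero: "act x 0 = x"
    and act_add: "act (act x \<theta>) \<eta> = act x (\<theta> + \<eta>)"
    and proj_act: "proj (act x \<theta>) = proj x"
    and act_free: "act x \<theta> = x \<Longrightarrow> \<theta> = 0"
    and act_transitive: "proj x = proj y \<Longrightarrow> \<exists>\<theta>. act x \<theta> = y"

definition club_in_bundle :: "('m::topological_space \<Rightarrow> long_ray) \<Rightarrow> 'm set \<Rightarrow> bool" where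
  "club_in_bundle proj F \<longleftrightarrow> closed F \<and> \<not> bdd_above (proj ` F)"

text \<open>
  The ordinal \<open>0\<close> is not a point of the long ray, so it is excluded from club subsets of \<open>\<omega>\<^sub>1\<close>;
  removing this isolated point affects neither closedness nor unboundedness.
\<close>

definition club_in_omega1 :: "omega1 set \<Rightarrow> bool" where
  "club_in_omega1 C \<longleftrightarrow> bot \<notin> C \<and> closed C \<and> \<not> bdd_above C"

text \<open>
  Over each point of \<open>C\<close> the set \<open>E\<close> has exactly \<open>n\<close> points, and they form an orbit of the rotation by
  \<open>2\<pi> / n\<close>. The case \<open>n = 0\<close> (empty fibres) is allowed; finiteness is stated separately because
  \<open>card\<close> is \<open>0\<close> on infinite sets.
\<close>

definition cyclic_over ::
  "('m \<Rightarrow> long_ray) \<Rightarrow> ('m \<Rightarrow> circle \<Rightarrow> 'm) \<Rightarrow> omega1 set \<Rightarrow> nat \<Rightarrow> 'm set \<Rightarrow> bool" where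
  "cyclic_over proj act C n E \<longleftrightarrow>
     (\<forall>\<alpha>\<in>C. finite (E \<inter> proj -` {ray_of \<alpha>}) \<and> card (E \<inter> proj -` {ray_of \<alpha>}) = n \<and>
        (\<forall>x \<in> proj -` {ray_of \<alpha>} \<inter> E.
           proj -` {ray_of \<alpha>} \<inter> E = {act x (angle (2 * pi * real k / real n)) | k. k < n}))"


section \<open>The trivial bundle\<close>

lemma angle_eq_iff: "angle x = angle y \<longleftrightarrow> cong_2pi x y"
  by (rule circle.abs_eq_iff)

lemma angle_surj: "\<exists>x. angle x = \<theta>"
  using Quotient_circle by (metis Quotient_def)

lemma angle_plus: "angle (x + y) = angle x + angle y"
  by (simp add: plus_circle.abs_eq)

lemma open_angle_image: "open (angle ` V)" if "open V"
proof -
  have "angle -` (angle ` V) = (\<Union>k::int. (+) (2 * pi * of_int k) ` V)"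
  proof (intro equalityI subsetI)
    fix x assume "x \<in> angle -` (angle ` V)"
    then obtain y where y: "y \<in> V" "cong_2pi x y"
      by (auto simp: angle_eq_iff)
    then obtain k :: int where "x - y = 2 * pi * of_int k"
      by (auto simp: cong_2pi_def)
    then have "x = 2 * pi * of_int k + y" by simp
    with y show "x \<in> (\<Union>k::int. (+) (2 * pi * of_int k) ` V)" by blast
  next
    fix x assume "x \<in> (\<Union>k::int. (+) (2 * pi * of_int k) ` V)"
    then obtain k :: int and y where "y \<in> V" "x = 2 * pi * of_int k + y" by blast
    then have "angle x = angle y"
      by (auto simp: angle_eq_iff cong_2pi_def)
    with \<open>y \<in> V\<close> show "x \<in> angle -` (angle ` V)" by simp
  qed
  moreover have "open (\<Union>k::int. (+) (2 * pi * of_int k) ` V)"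
    using that by (intro open_UN ballI open_translation)
  ultimately show ?thesis
    by (simp add: open_circle_def)
qed

lemma continuous_circle_plus: "continuous_on UNIV (\<lambda>(\<theta>, \<eta>). \<theta> + \<eta> :: circle)"
  unfolding continuous_on_open_vimage[OF open_UNIV]
proof (intro allI impI)
  fix U :: "circle set" assume "open U"
  let ?W = "{(x, y). angle (x + y) \<in> U}"
  have "open (angle -` U)"
    using \<open>open U\<close> by (simp add: open_circle_def)
  moreover have "continuous_on UNIV (\<lambda>z::real \<times> real. fst z + snd z)"
    by (intro continuous_intros)
  ultimately have "open ((\<lambda>z::real \<times> real. fst z + snd z) -` (angle -` U))"
    by (rule open_vimage)
  moreover have "?W = (\<lambda>z. fst z + snd z) -` (angle -` U)" by auto
  ultimately have W: "open ?W" by simp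
  show "open ((\<lambda>(\<theta>, \<eta>). \<theta> + \<eta>) -` U \<inter> UNIV)"
  proof (subst open_subopen, intro ballI)
    fix z assume z: "z \<in> (\<lambda>(\<theta>, \<eta>). \<theta> + \<eta>) -` U \<inter> UNIV"
    obtain x y where xy: "z = (angle x, angle y)"
      by (metis angle_surj surj_pair)
    with z have "(x, y) \<in> ?W" by (simp add: angle_plus)
    then obtain A B where AB: "open A" "open B" "x \<in> A" "y \<in> B" "A \<times> B \<subseteq> ?W"
      using W by (metis open_prod_elim mem_Sigma_iff)
    have "angle ` A \<times> angle ` B \<subseteq> (\<lambda>(\<theta>, \<eta>). \<theta> + \<eta>) -` U \<inter> UNIV"
      using AB(5) by (auto simp flip: angle_plus)
    moreover have "open (angle ` A \<times> angle ` B)"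
      using AB by (intro open_Times open_angle_image)
    moreover have "z \<in> angle ` A \<times> angle ` B"
      using xy AB by simp
    ultimately show "\<exists>T. open T \<and> z \<in> T \<and> T \<subseteq> (\<lambda>(\<theta>, \<eta>). \<theta> + \<eta>) -` U \<inter> UNIV"
      by blast
  qed
qed

lemma closed_zero_circle: "closed {0 :: circle}"
proof -
  have "angle -` (- {0}) = - ((\<lambda>x. x / (2 * pi)) -` \<int>)"
    by (auto simp: zero_circle.abs_eq angle_eq_iff cong_2pi_def Ints_def field_simps)
  moreover have "closed ((\<lambda>x::real. x / (2 * pi)) -` \<int>)"
    by (intro closed_vimage closed_Ints) (auto intro!: continuous_intros)
  ultimately show ?thesis
    by (simp add: closed_def open_circle_def)
qed

lemma not_bdd_above_long_ray: "\<not> bdd_above (UNIV :: long_ray set)"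
proof
  assume "bdd_above (UNIV :: long_ray set)"
  then obtain p :: long_ray where p: "\<And>q. q \<le> p"
    by (auto simp: bdd_above_def)
  let ?\<alpha> = "osuc (fst (Rep_long_ray p))"
  have "fst (Rep_long_ray p) < ?\<alpha>" by (rule less_osuc)
  moreover from this have "bot < ?\<alpha>"
    by (rule order.strict_trans1[OF bot_least])
  ultimately show False
    using p[of "ray_of ?\<alpha>"] by (auto simp: less_eq_long_ray_def Rep_ray_of)
qed

definition trivial_act :: "long_ray \<times> circle \<Rightarrow> circle \<Rightarrow> long_ray \<times> circle" where
  "trivial_act x \<theta> = (fst x, snd x + \<theta>)"

lemma trivial_bundle: "principal_circle_bundle fst trivial_act"
proof
  show "continuous_on UNIV (fst :: long_ray \<times> circle \<Rightarrow> _)"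
    by (intro continuous_intros)
  show "\<exists>U \<phi> \<psi>. open U \<and> p \<in> U \<and> homeomorphism (U \<times> (UNIV :: circle set)) (fst -` U) \<phi> \<psi> \<and>
         (\<forall>q\<in>U. \<forall>\<theta>. fst (\<phi> (q, \<theta>) :: long_ray \<times> circle) = q)" for p :: long_ray
    by (intro exI[of _ UNIV] exI[of _ id]) (auto simp: homeomorphism_def)
  have "continuous_on UNIV (\<lambda>z :: (long_ray \<times> circle) \<times> circle.
      (fst (fst z), (\<lambda>(\<theta>, \<eta>). \<theta> + \<eta>) (snd (fst z), snd z)))"
    by (intro continuous_intros continuous_on_compose2[OF continuous_circle_plus]) auto
  then show "continuous_on UNIV (\<lambda>(x, \<theta>). trivial_act x \<theta>)"
    by (simp add: trivial_act_def case_prod_unfold)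
  show "\<exists>\<theta>. trivial_act x \<theta> = y" if "fst x = fst y" for x y
    using that by (intro exI[of _ "snd y - snd x"]) (simp add: trivial_act_def prod_eq_iff)
qed (auto simp: trivial_act_def prod_eq_iff add.assoc)

text \<open>
  In the trivial bundle, \<open>F = M\<close> satisfies both of the alternatives \<open>F \<supseteq> \<pi>\<^sup>-\<^sup>1(C)\<close> and ``some
  club \<open>E \<subseteq> F\<close> is cyclic over \<open>C\<close>'', whatever \<open>C\<close> is: take for \<open>E\<close> the zero section. An exclusive
  dichotomy therefore has to say in the second alternative that the fibres over \<open>C\<close> are not
  contained in \<open>F\<close>.
\<close>

lemma trivial_bundle_both_alternatives:
  fixes C :: "omega1 set"
  defines "F \<equiv> (UNIV :: (long_ray \<times> circle) set)"
  shows "club_in_bundle fst F"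
    and "\<exists>g. homeomorphism ({..<p} \<times> UNIV) (fst -` {..<p}) (id :: long_ray \<times> circle \<Rightarrow> _) g"
    and "fst -` (ray_of ` C) \<subseteq> F"
    and "\<exists>(n::nat) E. E \<subseteq> F \<and> club_in_bundle fst E \<and> cyclic_over fst trivial_act C n E"
proof -
  show "club_in_bundle fst F"
    by (simp add: club_in_bundle_def F_def not_bdd_above_long_ray)
  show "\<exists>g. homeomorphism ({..<p} \<times> UNIV) (fst -` {..<p}) (id :: long_ray \<times> circle \<Rightarrow> _) g"
    by (intro exI[of _ id]) (auto simp: homeomorphism_def)
  show "fst -` (ray_of ` C) \<subseteq> F"
    by (simp add: F_def)
  let ?E = "(UNIV :: long_ray set) \<times> {0 :: circle}"
  have "?E \<inter> fst -` {p} = {(p, 0)}" "fst -` {p} \<inter> ?E = {(p, 0)}" for p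
    by auto
  then have "cyclic_over fst trivial_act C 1 ?E"
    by (simp add: cyclic_over_def trivial_act_def flip: zero_circle.abs_eq)
  moreover have "club_in_bundle fst ?E"
    by (simp add: club_in_bundle_def not_bdd_above_long_ray closed_Times closed_zero_circle)
  ultimately show "\<exists>(n::nat) E. E \<subseteq> F \<and> club_in_bundle fst E \<and> cyclic_over fst trivial_act C n E"
    unfolding F_def by blast
qed

end

theory Submission
  imports Defs
begin

text \<open>
  For a point \<open>x\<close> of the bundle, let \<open>A\<^sub>x\<close> be the closed set of angles \<open>\<theta>\<close> with \<open>x + \<theta> \<in> F\<close>. The idea is to
  pass to a club \<open>E \<subseteq> F\<close> on which \<open>A\<^sub>x\<close> no longer depends on \<open>x\<close>, at least beyond some point of the
  long ray. Once that is achieved the theorem is a statement about the symmetries of a single set: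
  if \<open>A\<close> is the common value of \<open>A\<^sub>x\<close>, then the part of \<open>E\<close> in a fibre is an orbit \<open>x + H\<close> of the
  stabiliser \<open>H = {\<eta>. \<eta> + A = A}\<close>, a closed subgroup of the circle. If \<open>A\<close> is the whole circle, then \<open>F\<close>
  contains whole fibres and the first alternative holds. Otherwise \<open>H\<close> is a proper closed subgroup,
  hence generated by the rotation by \<open>2\<pi> / n\<close> for some \<open>n\<close> (\<open>closed_subgroup_circle_cases\<close>), and \<open>E\<close>
  witnesses the second alternative.

  To make \<open>A\<^sub>x\<close> constant, note that it is determined by which intervals of a countable family of
  compact intervals it meets, and that for each such interval the points \<open>x\<close> with \<open>A\<^sub>x\<close> meeting it form
  a closed set \<open>G\<^sub>n\<close>. Thus it is enough to decide countably many closed sets \<open>G\<^sub>n\<close>, and this is done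
  greedily (\<open>club_deciding_closed_sets\<close>): start with \<open>F\<close>, and at stage \<open>n\<close> intersect the current club
  with \<open>G\<^sub>n\<close> if the result is still unbounded. If it is bounded, then the current club avoids
  \<open>G\<^sub>n\<close> from some point on, and countably many such points have a common upper bound. The
  intersection of all stages is \<open>E\<close>.

  That \<open>E\<close> is unbounded, and that it meets the fibres over a club of ordinals, both rest on the
  same compactness property (\<open>convergent_subsequence_over_limit\<close>): because the fibres are circles, a
  sequence in the bundle whose projections converge has a convergent subsequence. Only sequences
  are needed, because every countable ordinal that is a limit point of a set from below is the limit
  of a sequence in that set.
\<close>

section \<open>Sequences of countable ordinals\<close>

lemma bot_less_omega1: "\<alpha> < \<beta> \<Longrightarrow> bot < \<beta>" for \<alpha> \<beta> :: omega1
  using order.strict_trans1[OF bot_least] .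

lemma countable_imp_bdd_above_omega1:
  fixes A :: "omega1 set"
  assumes "countable A"
  shows "bdd_above A"
proof (rule ccontr)
  assume "\<not> bdd_above A"
  then have "UNIV = (\<Union>\<alpha>\<in>A. {..<\<alpha>})"
    by (auto simp: bdd_above_def not_le)
  also have "countable \<dots>"
    using assms countable_lessThan_omega1 by blast
  finally show False
    using uncountable_omega1 by blast
qed

lemma strict_mono_omega1_converges:
  fixes X :: "nat \<Rightarrow> omega1"
  assumes "strict_mono X"
  obtains \<alpha> where "X \<longlonglongrightarrow> \<alpha>" "\<And>n. X n < \<alpha>"
proof -
  define \<alpha> where "\<alpha> = (LEAST \<beta>. \<forall>n. X n \<le> \<beta>)"
  have "\<exists>\<beta>. \<forall>n. X n \<le> \<beta>"
    using countable_imp_bdd_above_omega1[of "range X"] by (auto simp: bdd_above_def)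
  then have "\<forall>n. X n \<le> \<alpha>"
    unfolding \<alpha>_def by (rule LeastI_ex)
  then have less: "X n < \<alpha>" for n
    using assms by (meson lessI less_le_trans strict_mono_less)
  have "X \<longlonglongrightarrow> \<alpha>"
  proof (rule order_tendstoI)
    fix \<beta> assume "\<beta> < \<alpha>"
    then obtain n where "\<beta> < X n"
      using not_less_Least[of \<beta> "\<lambda>\<beta>. \<forall>n. X n \<le> \<beta>"] by (auto simp: \<alpha>_def not_le)
    then show "\<forall>\<^sub>F k in sequentially. \<beta> < X k"
      using assms unfolding eventually_sequentially
      by (meson less_le_trans strict_mono_less_eq)
  next
    fix \<beta> assume "\<alpha> < \<beta>"
    then show "\<forall>\<^sub>F k in sequentially. X k < \<beta>"
      using less by (auto intro: always_eventually order.strict_trans)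
  qed
  with less show thesis by (rule that[rotated])
qed

text \<open>
  Initial segments of \<open>\<omega>\<^sub>1\<close> are countable, so each limit point of a set has countable cofinality: the
  sequence in the set runs past every member of an enumeration of the ordinals below the limit point.
\<close>

lemma closed_omega1_sequentiallyI:
  fixes S :: "omega1 set"
  assumes lim: "\<And>X \<alpha>. strict_mono X \<Longrightarrow> X \<longlonglongrightarrow> \<alpha> \<Longrightarrow> (\<And>n. X n < \<alpha>) \<Longrightarrow> (\<And>n. X n \<in> S) \<Longrightarrow> \<alpha> \<in> S"
  shows "closed S"
proof -
  have "\<alpha> \<in> S" if "\<alpha> \<in> closure S" for \<alpha>
  proof (rule ccontr)
    assume "\<alpha> \<notin> S"
    have initial: "{..<osuc \<alpha>} = {..\<alpha>}"
      using less_osuc[of \<alpha>] by (auto simp: osuc_def intro: not_less_Least dest: not_less_Least simp flip: not_less)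
    have below: "\<exists>\<sigma>\<in>S. \<sigma> < \<alpha>"
    proof -
      have "open {..<osuc \<alpha>}" "\<alpha> \<in> {..<osuc \<alpha>}"
        using less_osuc by auto
      then obtain \<sigma> where "\<sigma> \<in> S" "\<sigma> \<in> {..<osuc \<alpha>}"
        using \<open>\<alpha> \<in> closure S\<close> by (meson closure_iff_nhds_not_empty disjoint_iff order_refl)
      with \<open>\<alpha> \<notin> S\<close> show ?thesis
        unfolding initial by (auto simp: less_le)
    qed
    have cofinal: "\<exists>\<sigma>\<in>S. \<beta> < \<sigma> \<and> \<sigma> < \<alpha>" if "\<beta> < \<alpha>" for \<beta>
    proof -
      have "open ({\<beta><..} \<inter> {..<osuc \<alpha>})" "\<alpha> \<in> {\<beta><..} \<inter> {..<osuc \<alpha>}"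
        using less_osuc that by auto
      then obtain \<sigma> where "\<sigma> \<in> S" "\<sigma> \<in> {\<beta><..} \<inter> {..<osuc \<alpha>}"
        using \<open>\<alpha> \<in> closure S\<close> by (meson closure_iff_nhds_not_empty disjoint_iff order_refl)
      with \<open>\<alpha> \<notin> S\<close> show ?thesis
        unfolding initial by (auto simp: less_le)
    qed
    define e where "e = from_nat_into {..<\<alpha>}"
    have ne: "{..<\<alpha>} \<noteq> {}"
      using below by auto
    have e_less: "e n < \<alpha>" for n
      using from_nat_into[OF ne] by (auto simp: e_def)
    have "\<exists>X. \<forall>n. (X n \<in> S \<and> X n < \<alpha>) \<and> max (X n) (e n) < X (Suc n)"
    proof (rule dependent_nat_choice)
      show "\<exists>\<sigma>. \<sigma> \<in> S \<and> \<sigma> < \<alpha>"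
        using below by blast
    next
      fix \<sigma> n assume "\<sigma> \<in> S \<and> \<sigma> < \<alpha>"
      then show "\<exists>\<tau>. (\<tau> \<in> S \<and> \<tau> < \<alpha>) \<and> max \<sigma> (e n) < \<tau>"
        using cofinal[of "max \<sigma> (e n)"] e_less by auto
    qed
    then obtain X where X: "\<And>n. X n \<in> S" "\<And>n. X n < \<alpha>" "\<And>n. max (X n) (e n) < X (Suc n)"
      by blast
    have "strict_mono X"
      using X(3) by (auto simp: strict_mono_Suc_iff)
    moreover have "X \<longlonglongrightarrow> \<alpha>"
    proof (rule order_tendstoI)
      fix \<beta> assume "\<beta> < \<alpha>"
      then obtain n where "\<beta> = e n"
        unfolding e_def using from_nat_into_surj[OF countable_lessThan_omega1] by (metis lessThan_iff)
      then have "\<beta> < X (Suc n)"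
        using X(3) by simp
      then show "\<forall>\<^sub>F k in sequentially. \<beta> < X k"
        using \<open>strict_mono X\<close> unfolding eventually_sequentially
        by (meson less_le_trans strict_mono_less_eq)
    next
      fix \<beta> assume "\<alpha> < \<beta>"
      then show "\<forall>\<^sub>F k in sequentially. X k < \<beta>"
        using X(2) by (auto intro: always_eventually order.strict_trans)
    qed
    ultimately show False
      using lim X \<open>\<alpha> \<notin> S\<close> by blast
  qed
  then show ?thesis
    by (metis closed_closure closure_subset subsetI subset_antisym)
qed


section \<open>Ordinals in the long ray\<close>

lemma ray_of_less_iff: "bot < \<alpha> \<Longrightarrow> bot < \<beta> \<Longrightarrow> ray_of \<alpha> < ray_of \<beta> \<longleftrightarrow> \<alpha> < \<beta>"
  by (auto simp: less_long_ray_def less_eq_long_ray_def Rep_ray_of)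

lemma ray_of_le_iff: "bot < \<alpha> \<Longrightarrow> bot < \<beta> \<Longrightarrow> ray_of \<alpha> \<le> ray_of \<beta> \<longleftrightarrow> \<alpha> \<le> \<beta>"
  by (auto simp: less_eq_long_ray_def Rep_ray_of)

lemma less_ray_ofI: "fst (Rep_long_ray p) < \<beta> \<Longrightarrow> p < ray_of \<beta>"
  using bot_less_omega1[of "fst (Rep_long_ray p)" \<beta>]
  by (auto simp: less_long_ray_def less_eq_long_ray_def Rep_ray_of)

lemma less_ray_ofD: "p < ray_of \<beta> \<Longrightarrow> bot < \<beta> \<Longrightarrow> fst (Rep_long_ray p) < \<beta>"
  using Rep_long_ray[of p] by (auto simp: less_long_ray_def less_eq_long_ray_def Rep_ray_of)

lemma ex_ordinal_above: "\<exists>\<beta>>\<alpha>. p < ray_of \<beta>"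
proof (intro exI conjI)
  show "\<alpha> < osuc (max \<alpha> (fst (Rep_long_ray p)))"
    using less_osuc by (metis max_less_iff_conj)
  show "p < ray_of (osuc (max \<alpha> (fst (Rep_long_ray p))))"
    using less_osuc by (intro less_ray_ofI) (metis max_less_iff_conj)
qed

lemma tendsto_ray_of:
  assumes X: "X \<longlonglongrightarrow> \<alpha>" "\<And>n. X n < \<alpha>"
    and p: "\<And>n. ray_of (X n) \<le> p n" "\<And>n. p n \<le> ray_of \<alpha>"
  shows "p \<longlonglongrightarrow> ray_of \<alpha>"
proof (rule order_tendstoI)
  fix q assume "q < ray_of \<alpha>"
  then have "fst (Rep_long_ray q) < \<alpha>"
    using X(2) bot_less_omega1 by (blast intro: less_ray_ofD)
  with X(1) have "\<forall>\<^sub>F n in sequentially. fst (Rep_long_ray q) < X n"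
    by (rule order_tendstoD)
  then show "\<forall>\<^sub>F n in sequentially. q < p n"
    by eventually_elim (use p(1) less_ray_ofI less_le_trans in blast)
next
  fix q assume "ray_of \<alpha> < q"
  then show "\<forall>\<^sub>F n in sequentially. p n < q"
    using p(2) by (auto intro: always_eventually order.strict_trans1)
qed


section \<open>Closed subgroups of the real line\<close>

text \<open>
  Everything depends on the infimum \<open>d\<close> of the positive elements. If \<open>d = 0\<close>, then multiples of small
  elements are dense. If \<open>d > 0\<close>, then \<open>d\<close> belongs to the subgroup, and division with remainder shows
  that it is a generator; in particular \<open>c\<close> is a multiple \<open>n d\<close>.
\<close>

lemma closed_subgroup_real_cases:
  fixes H :: "real set"
  assumes "closed H" and diff: "\<And>x y. x \<in> H \<Longrightarrow> y \<in> H \<Longrightarrow> x - y \<in> H"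
    and "c \<in> H" "0 < c"
  obtains "H = UNIV" | n :: nat where "0 < n" "H = range (\<lambda>k::int. c * of_int k / of_nat n)"
proof -
  have zero: "0 \<in> H"
    using diff[OF \<open>c \<in> H\<close> \<open>c \<in> H\<close>] by simp
  have minus: "- x \<in> H" if "x \<in> H" for x
    using diff[OF zero that] by simp
  have add: "x + y \<in> H" if "x \<in> H" "y \<in> H" for x y
    using diff[OF that(1) minus[OF that(2)]] by simp
  have mult_nat: "of_nat k * x \<in> H" if "x \<in> H" for k x
    by (induction k) (use zero add that in \<open>auto simp: algebra_simps\<close>)
  have mult: "of_int k * x \<in> H" if "x \<in> H" for k x
    using mult_nat[OF that] minus[OF mult_nat[OF that]] by (cases k) (auto simp del: of_nat_Suc)
  define P where "P = H \<inter> {0<..}"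
  define d where "d = Inf P"
  have P: "P \<noteq> {}" "bdd_below P"
    using \<open>c \<in> H\<close> \<open>0 < c\<close> by (auto simp: P_def intro!: bdd_belowI[of _ 0])
  have "0 \<le> d"
    unfolding d_def using P(1) by (rule cInf_greatest) (auto simp: P_def)
  have remainder: "0 \<le> x - of_int \<lfloor>x / h\<rfloor> * h" "x - of_int \<lfloor>x / h\<rfloor> * h < h" if "0 < h" for x h :: real
    using floor_divide_lower[OF that, of x] floor_divide_upper[OF that, of x]
    by (auto simp: algebra_simps)
  show thesis
  proof (cases "d = 0")
    case True
    have "x \<in> closure H" for x
      unfolding closure_approachable
    proof (intro allI impI)
      fix e :: real assume "0 < e"
      then obtain h where h: "h \<in> P" "h < e"
        using True P cInf_less_iff[of P e] by (auto simp: d_def)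
      then have "0 < h" "h \<in> H"
        by (auto simp: P_def)
      then show "\<exists>y\<in>H. dist y x < e"
        using mult remainder[OF \<open>0 < h\<close>, of x] h
        by (intro bexI[of _ "of_int \<lfloor>x / h\<rfloor> * h"]) (auto simp: dist_real_def)
    qed
    with \<open>closed H\<close> have "H = UNIV"
      by auto
    then show thesis by (rule that(1))
  next
    case False
    with \<open>0 \<le> d\<close> have "0 < d" by simp
    have "d \<in> closure P"
      unfolding d_def using P by (rule closure_contains_Inf)
    also have "\<dots> \<subseteq> H"
      using \<open>closed H\<close> by (intro closure_minimal) (auto simp: P_def)
    finally have "d \<in> H" .
    have multiple: "x = of_int \<lfloor>x / d\<rfloor> * d" if "x \<in> H" for x
    proof (rule ccontr)
      assume "x \<noteq> of_int \<lfloor>x / d\<rfloor> * d"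
      then have "x - of_int \<lfloor>x / d\<rfloor> * d \<in> P"
        using remainder[OF \<open>0 < d\<close>, of x] diff[OF that mult[OF \<open>d \<in> H\<close>]] by (auto simp: P_def)
      then have "d \<le> x - of_int \<lfloor>x / d\<rfloor> * d"
        unfolding d_def using P(2) by (rule cInf_lower)
      with remainder(2)[OF \<open>0 < d\<close>, of x] show False by simp
    qed
    define n where "n = nat \<lfloor>c / d\<rfloor>"
    have c: "c = of_int \<lfloor>c / d\<rfloor> * d"
      using multiple[OF \<open>c \<in> H\<close>] .
    have "0 < \<lfloor>c / d\<rfloor>"
    proof -
      have "0 < real_of_int \<lfloor>c / d\<rfloor> * d"
        using c \<open>0 < c\<close> by simp
      with \<open>0 < d\<close> show ?thesis
        by (simp add: zero_less_mult_iff)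
    qed
    then have "0 < n" "c = of_nat n * d"
      using c by (auto simp: n_def)
    moreover have "H = range (\<lambda>k::int. c * of_int k / of_nat n)"
    proof -
      have "c * of_int k / of_nat n = of_int k * d" for k
        using calculation by simp
      then show ?thesis
        using multiple mult[OF \<open>d \<in> H\<close>] by auto
    qed
    ultimately show thesis by (intro that(2))
  qed
qed


section \<open>Closed subgroups of the circle\<close>

lemma continuous_on_angle: "continuous_on S angle"
  by (rule continuous_on_subset[OF _ subset_UNIV])
    (auto simp: continuous_on_open_vimage open_circle_def)

lemma angle_minus: "angle (x - y) = angle x - angle y"
  by (simp add: minus_circle.abs_eq)

lemma angle_2pi: "angle (2 * pi) = 0"
  by (auto simp: zero_circle.abs_eq angle_eq_iff cong_2pi_def intro!: exI[of _ 1])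

lemma angle_bounded_representative:
  obtains t where "t \<in> {0..2 * pi}" "angle t = \<theta>"
proof -
  obtain x where x: "angle x = \<theta>"
    using angle_surj by blast
  define t where "t = x - of_int \<lfloor>x / (2 * pi)\<rfloor> * (2 * pi)"
  have "cong_2pi t x"
    unfolding cong_2pi_def t_def by (intro exI[of _ "- \<lfloor>x / (2 * pi)\<rfloor>"]) simp
  with x have "angle t = \<theta>"
    by (simp flip: angle_eq_iff)
  moreover have "t \<in> {0..2 * pi}"
    using floor_divide_lower[of "2 * pi" x] floor_divide_upper[of "2 * pi" x]
    by (auto simp: t_def algebra_simps)
  ultimately show thesis by (rule that[rotated])
qed

lemma angle_fraction_eq_iff:
  assumes "0 < n"
  shows "angle (2 * pi * of_int j / of_nat n) = angle (2 * pi * of_int k / of_nat n)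
    \<longleftrightarrow> int n dvd j - k"
proof -
  have "(2 * pi * of_int j / of_nat n - 2 * pi * of_int k / of_nat n = 2 * pi * of_int l)
      \<longleftrightarrow> j - k = int n * l" for l
  proof -
    have "(2 * pi * of_int j / of_nat n - 2 * pi * of_int k / of_nat n = 2 * pi * of_int l)
      \<longleftrightarrow> real_of_int (j - k) = real_of_int (int n * l)"
    proof -
      have "2 * pi * of_int j / of_nat n - 2 * pi * of_int k / of_nat n - 2 * pi * of_int l
          = 2 * pi / of_nat n * (of_int (j - k) - of_int (int n * l))"
        using assms by (simp add: field_simps)
      moreover have "2 * pi / of_nat n \<noteq> 0"
        using assms by simp
      ultimately show ?thesis
        by (metis eq_iff_diff_eq_0 mult_eq_0_iff)
    qed
    then show ?thesis
      by (simp only: of_int_eq_iff)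
  qed
  then show ?thesis
    by (auto simp: angle_eq_iff cong_2pi_def dvd_def)
qed

text \<open>
  The preimage in the reals is a closed subgroup containing \<open>2\<pi>\<close>.
\<close>

lemma closed_subgroup_circle_cases:
  fixes H :: "circle set"
  assumes "closed H" "0 \<in> H" "\<And>\<theta> \<eta>. \<theta> \<in> H \<Longrightarrow> \<eta> \<in> H \<Longrightarrow> \<theta> - \<eta> \<in> H"
  obtains "H = UNIV"
  | n :: nat where "card H = n" "finite H" "H = {angle (2 * pi * real k / real n) | k. k < n}"
proof -
  have "closed (angle -` H)"
    using \<open>closed H\<close> by (auto simp: closed_def open_circle_def vimage_Compl)
  moreover have "x - y \<in> angle -` H" if "x \<in> angle -` H" "y \<in> angle -` H" for x y
    using assms(3) that by (simp add: angle_minus)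
  moreover have "2 * pi \<in> angle -` H"
    using \<open>0 \<in> H\<close> by (simp add: angle_2pi)
  ultimately consider "angle -` H = UNIV"
    | n :: nat where "0 < n" "angle -` H = range (\<lambda>k::int. 2 * pi * of_int k / of_nat n)"
    by (rule closed_subgroup_real_cases[where c = "2 * pi"]) auto
  then show thesis
  proof cases
    case 1
    then have "H = UNIV"
      using angle_surj by (metis UNIV_eq_I UNIV_I vimageE)
    then show thesis by (rule that(1))
  next
    case (2 n)
    let ?z = "\<lambda>k. angle (2 * pi * real k / real n)"
    have "H = angle ` (angle -` H)"
      using angle_surj by (metis surj_def surj_image_vimage_eq)
    also have "\<dots> = range (\<lambda>k::int. angle (2 * pi * of_int k / of_nat n))"
      unfolding 2(2) by auto
    also have "\<dots> = ?z ` {..<n}"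
    proof (intro equalityI subsetI)
      fix \<theta> assume "\<theta> \<in> range (\<lambda>k::int. angle (2 * pi * of_int k / of_nat n))"
      then obtain k :: int where k: "\<theta> = angle (2 * pi * of_int k / of_nat n)"
        by blast
      define j where "j = nat (k mod int n)"
      have j: "int j = k mod int n" "j < n"
        using \<open>0 < n\<close> by (auto simp: j_def nat_less_iff)
      have "\<theta> = angle (2 * pi * of_int (int j) / of_nat n)"
        unfolding k angle_fraction_eq_iff[OF \<open>0 < n\<close>] by (simp add: j)
      with j(2) show "\<theta> \<in> ?z ` {..<n}"
        by (intro image_eqI[of _ _ j]) auto
    next
      fix \<theta> assume "\<theta> \<in> ?z ` {..<n}"
      then obtain k where "\<theta> = ?z k" by blast
      then show "\<theta> \<in> range (\<lambda>k::int. angle (2 * pi * of_int k / of_nat n))"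
        by (intro image_eqI[of _ _ "int k"]) auto
    qed
    finally have H: "H = ?z ` {..<n}" .
    have "inj_on ?z {..<n}"
    proof (rule inj_onI)
      fix j k assume jk: "j \<in> {..<n}" "k \<in> {..<n}" "?z j = ?z k"
      then have "int n dvd int j - int k"
        using angle_fraction_eq_iff[OF \<open>0 < n\<close>, of "int j" "int k"] by simp
      then have "int j mod int n = int k mod int n"
        by (simp add: mod_eq_dvd_iff)
      with jk show "j = k" by simp
    qed
    with H have "card H = n"
      by (simp add: card_image)
    with H show thesis
      by (intro that(2)) auto
  qed
qed


section \<open>Countably many probes for closed sets of reals\<close>

text \<open>
  The intervals have to be compact, and not merely a basis of the line, because the set of points
  whose orbit under a set of angles meets a closed set is closed only if that set of angles is
  compact. Pairs with \<open>a > b\<close> give the empty interval, which is harmless.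
\<close>

definition rational_interval :: "nat \<Rightarrow> real set" where
  "rational_interval n = (case from_nat n of (a, b) \<Rightarrow> {of_rat a..of_rat b})"

lemma compact_rational_interval: "compact (rational_interval n)"
  by (auto simp: rational_interval_def split: prod.split)

lemma closed_eq_if_same_rational_intervals:
  fixes S T :: "real set"
  assumes "closed S" "closed T"
    and same: "\<And>n. S \<inter> rational_interval n = {} \<longleftrightarrow> T \<inter> rational_interval n = {}"
  shows "S = T"
proof -
  have "S' \<subseteq> T'"
    if "closed T'" and same': "\<And>n. S' \<inter> rational_interval n = {} \<longleftrightarrow> T' \<inter> rational_interval n = {}"
    for S' T' :: "real set"
  proof
    fix x assume "x \<in> S'"
    have "x \<in> closure T'"
      unfolding closure_approachable
    proof (intro allI impI)
      fix e :: real assume "0 < e"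
      obtain a where a: "x - e / 2 < of_rat a" "of_rat a < x"
        using of_rat_dense[of "x - e / 2" x] \<open>0 < e\<close> by auto
      obtain b where b: "x < of_rat b" "of_rat b < x + e / 2"
        using of_rat_dense[of x "x + e / 2"] \<open>0 < e\<close> by auto
      have I: "rational_interval (to_nat (a, b)) = {of_rat a..of_rat b}"
        by (simp add: rational_interval_def)
      have "S' \<inter> rational_interval (to_nat (a, b)) \<noteq> {}"
        using a b \<open>x \<in> S'\<close> I by auto
      then obtain y where "y \<in> T'" "y \<in> {of_rat a..of_rat b}"
        using same' I by blast
      with a b show "\<exists>y\<in>T'. dist y x < e"
        by (intro bexI[of _ y]) (auto simp: dist_real_def abs_if)
    qed
    with \<open>closed T'\<close> show "x \<in> T'" by simp
  qed
  with assms show ?thesis by (meson subset_antisym)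
qed


section \<open>Clubs in the bundle\<close>

context principal_circle_bundle
begin

lemma act_cancel: "act (act x \<theta>) (- \<theta>) = x"
  by (simp add: act_add act_zero)

lemma act_inject: "act x \<theta> = act x \<eta> \<longleftrightarrow> \<theta> = \<eta>"
proof
  assume eq: "act x \<theta> = act x \<eta>"
  have "act x (\<theta> - \<eta>) = act (act x \<theta>) (- \<eta>)"
    by (simp add: act_add)
  also have "\<dots> = x"
    unfolding eq by (rule act_cancel)
  finally show "\<theta> = \<eta>"
    using act_free by fastforce
qed simp

lemma continuous_on_act_angle: "continuous_on UNIV (\<lambda>(x, t). act x (angle t))"
proof -
  have "continuous_on UNIV (\<lambda>z. (fst z :: 'm, angle (snd z)))"
    by (intro continuous_intros continuous_on_compose2[OF continuous_on_angle[of UNIV]]) auto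
  from continuous_on_compose2[OF continuous_act this] show ?thesis
    by (simp add: case_prod_unfold)
qed

lemma closed_orbit_hits:
  assumes "closed F"
  shows "closed {t. act x (angle t) \<in> F}"
proof -
  have "continuous_on UNIV (\<lambda>t. act x (angle t))"
    using continuous_on_compose2[OF continuous_on_act_angle, of UNIV "\<lambda>t. (x, t)"]
    by (simp add: continuous_on_Pair continuous_on_const continuous_on_id)
  with assms have "closed ((\<lambda>t. act x (angle t)) -` F)"
    by (intro closed_vimage)
  then show ?thesis
    by (simp add: vimage_def)
qed

text \<open>
  This set is a projection of a closed set along the compact factor \<open>K\<close>; hence the tube lemma.
\<close>

lemma closed_hitting_set:
  assumes "closed F" "compact K"
  shows "closed {x. \<exists>t\<in>K. act x (angle t) \<in> F}"
proof -
  let ?W = "(\<lambda>(x, t). act x (angle t)) -` (- F)"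
  have W: "open ?W"
    using \<open>closed F\<close> continuous_on_act_angle by (intro open_vimage) auto
  have "open {x. {x} \<times> K \<subseteq> ?W}"
  proof (subst open_subopen, intro ballI)
    fix x assume "x \<in> {x. {x} \<times> K \<subseteq> ?W}"
    then obtain X where "x \<in> X" "open X" "X \<times> K \<subseteq> ?W"
      using Elementary_Topology.tube_lemma[OF \<open>compact K\<close> W] by blast
    then show "\<exists>X. open X \<and> x \<in> X \<and> X \<subseteq> {x. {x} \<times> K \<subseteq> ?W}"
      by blast
  qed
  moreover have "{x. {x} \<times> K \<subseteq> ?W} = - {x. \<exists>t\<in>K. act x (angle t) \<in> F}"
    by auto
  ultimately show ?thesis
    by (simp add: closed_def)
qed

text \<open>
  Near \<open>p\<close> the bundle is a product with the circle, and the angular coordinates have representatives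
  in the compact interval \<open>[0, 2\<pi>]\<close>.
\<close>

lemma convergent_subsequence_over_limit:
  assumes lim: "(\<lambda>n. proj (x n)) \<longlonglongrightarrow> p"
  obtains y r where "strict_mono (r :: nat \<Rightarrow> nat)" "(x \<circ> r) \<longlonglongrightarrow> y" "proj y = p"
proof -
  obtain U \<phi> \<psi> where U: "open U" "p \<in> U"
    and homeo: "homeomorphism (U \<times> (UNIV :: circle set)) (proj -` U) \<phi> \<psi>"
    and fibre: "\<And>q \<theta>. q \<in> U \<Longrightarrow> proj (\<phi> (q, \<theta>)) = q"
    using locally_trivial[of p] by blast
  have chart: "\<exists>t\<in>{0..2 * pi}. \<phi> (proj z, angle t) = z" if "proj z \<in> U" for z
  proof -
    have "z \<in> \<phi> ` (U \<times> UNIV)"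
      using homeo that by (simp add: homeomorphism_def)
    then obtain q \<theta> where "q \<in> U" "z = \<phi> (q, \<theta>)" by auto
    moreover obtain t where "t \<in> {0..2 * pi}" "angle t = \<theta>"
      by (rule angle_bounded_representative)
    ultimately show ?thesis
      using fibre by auto
  qed
  obtain t where t: "\<And>n. t n \<in> {0..2 * pi}"
    and xt: "\<And>n. proj (x n) \<in> U \<Longrightarrow> \<phi> (proj (x n), angle (t n)) = x n"
  proof -
    have "\<forall>n. \<exists>t. t \<in> {0..2 * pi} \<and> (proj (x n) \<in> U \<longrightarrow> \<phi> (proj (x n), angle t) = x n)"
      using chart by (metis angle_bounded_representative)
    then show thesis using that by metis
  qed
  obtain s r where sr: "strict_mono (r :: nat \<Rightarrow> nat)" "(t \<circ> r) \<longlonglongrightarrow> s"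
    using compact_Icc[of 0 "2 * pi"] t unfolding compact_def by blast
  have plim: "(\<lambda>n. proj (x (r n))) \<longlonglongrightarrow> p"
    using LIMSEQ_subseq_LIMSEQ[OF lim sr(1)] by (simp add: comp_def)
  have "(\<lambda>n. angle (t (r n))) \<longlonglongrightarrow> angle s"
    using continuous_on_tendsto_compose[OF continuous_on_angle[of UNIV] sr(2)] by (simp add: comp_def)
  with plim have pair: "(\<lambda>n. (proj (x (r n)), angle (t (r n)))) \<longlonglongrightarrow> (p, angle s)"
    by (rule tendsto_Pair)
  have "continuous_on (U \<times> UNIV) \<phi>"
    using homeo by (simp add: homeomorphism_def)
  moreover have inU: "\<forall>\<^sub>F n in sequentially. proj (x (r n)) \<in> U"
    using topological_tendstoD[OF plim U] .
  ultimately have "(\<lambda>n. \<phi> (proj (x (r n)), angle (t (r n)))) \<longlonglongrightarrow> \<phi> (p, angle s)"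
    using U(2) by (intro continuous_on_tendsto_compose[OF _ pair]) auto
  moreover have "\<forall>\<^sub>F n in sequentially. \<phi> (proj (x (r n)), angle (t (r n))) = (x \<circ> r) n"
    using inU by eventually_elim (simp add: xt)
  ultimately have "(x \<circ> r) \<longlonglongrightarrow> \<phi> (p, angle s)"
    by (rule Lim_transform_eventually)
  with sr(1) show thesis
    using fibre U that by blast
qed

text \<open>
  The usual interleaving argument: choose \<open>x\<^sub>n \<in> S\<^sub>n\<close> whose projections alternate with an increasing
  sequence of ordinals. Both sequences have the same limit, an ordinal \<open>\<alpha>\<close>, and any limit over \<open>\<alpha>\<close> of
  a subsequence of the \<open>x\<^sub>n\<close> lies in every \<open>S\<^sub>n\<close>. For a constant sequence \<open>S\<close> this says that a club meets
  the fibres over unboundedly many ordinals.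
\<close>

lemma decreasing_clubs_meet_over_ordinal:
  assumes "decseq S" and closed: "\<And>n. closed (S n)"
    and unbounded: "\<And>n. \<not> bdd_above (proj ` S n)"
  obtains \<alpha> y where "\<gamma> < \<alpha>" "proj y = ray_of \<alpha>" "\<And>n. y \<in> S n"
proof -
  let ?P = "\<lambda>n z. snd z \<in> S n \<and> \<gamma> < fst z \<and> ray_of (fst z) < proj (snd z)"
  let ?Q = "\<lambda>n z z'. proj (snd z) < ray_of (fst z')"
  have pick: "\<exists>x\<in>S n. ray_of \<beta> < proj x" for n \<beta>
    using unbounded[of n] by (auto simp: bdd_above_def not_le)
  have "\<exists>g. \<forall>n. ?P n (g n) \<and> ?Q n (g n) (g (Suc n))"
  proof (rule dependent_nat_choice)
    show "\<exists>z. ?P 0 z"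
      using pick[of 0 "osuc \<gamma>"] less_osuc by auto
  next
    fix z n
    obtain \<beta>' where "\<gamma> < \<beta>'" "proj (snd z) < ray_of \<beta>'"
      using ex_ordinal_above by blast
    then show "\<exists>z'. ?P (Suc n) z' \<and> ?Q n z z'"
      using pick[of "Suc n" \<beta>'] by auto
  qed
  then obtain g where g: "\<And>n. ?P n (g n)" "\<And>n. ?Q n (g n) (g (Suc n))"
    by blast
  define X where "X n = fst (g n)" for n
  define x where "x n = snd (g n)" for n
  have x: "x n \<in> S n" and X_gt: "\<gamma> < X n" and lower: "ray_of (X n) < proj (x n)"
    and upper: "proj (x n) < ray_of (X (Suc n))" for n
    using g[of n] by (auto simp: X_def x_def)
  have "X n < X (Suc n)" for n
    using less_trans[OF lower upper] bot_less_omega1[OF X_gt] by (simp add: ray_of_less_iff)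
  then have "strict_mono X"
    by (simp add: strict_mono_Suc_iff)
  then obtain \<alpha> where \<alpha>: "X \<longlonglongrightarrow> \<alpha>" "\<And>n. X n < \<alpha>"
    using strict_mono_omega1_converges by blast
  have "proj (x n) \<le> ray_of \<alpha>" for n
  proof -
    have "ray_of (X (Suc n)) < ray_of \<alpha>"
      using \<alpha>(2)[of "Suc n"] bot_less_omega1[OF X_gt] bot_less_omega1[OF \<alpha>(2)] by (simp add: ray_of_less_iff)
    with upper[of n] show ?thesis by simp
  qed
  then have "(\<lambda>n. proj (x n)) \<longlonglongrightarrow> ray_of \<alpha>"
    using lower by (intro tendsto_ray_of[OF \<alpha>]) (auto intro: less_imp_le)
  then obtain r y where ry: "strict_mono (r :: nat \<Rightarrow> nat)" "(x \<circ> r) \<longlonglongrightarrow> y" "proj y = ray_of \<alpha>"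
    by (rule convergent_subsequence_over_limit)
  have "y \<in> S n" for n
  proof (rule Lim_in_closed_set[OF closed _ _ ry(2)])
    show "\<forall>\<^sub>F k in sequentially. (x \<circ> r) k \<in> S n"
      using eventually_ge_at_top[of n]
    proof eventually_elim
      case (elim k)
      then have "n \<le> r k"
        using seq_suble[OF ry(1), of k] by simp
      then show ?case
        using x[of "r k"] decseqD[OF \<open>decseq S\<close>] by auto
    qed
  qed simp
  moreover have "\<gamma> < \<alpha>"
    using X_gt \<alpha>(2) less_trans by blast
  ultimately show thesis
    using that ry(3) by blast
qed

lemma unbounded_decreasing_INT:
  assumes "decseq S" "\<And>n. closed (S n)" "\<And>n. \<not> bdd_above (proj ` S n)"
  shows "\<not> bdd_above (proj ` (\<Inter>n. S n))"
proof
  assume "bdd_above (proj ` (\<Inter>n. S n))"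
  then obtain p where p: "\<And>x. (\<And>n. x \<in> S n) \<Longrightarrow> proj x \<le> p"
    by (force simp: bdd_above_def)
  obtain \<alpha> y where y: "fst (Rep_long_ray p) < \<alpha>" "proj y = ray_of \<alpha>" "\<And>n. y \<in> S n"
    using decreasing_clubs_meet_over_ordinal[OF assms] by metis
  with p[of y] less_ray_ofI[OF y(1)] show False
    by simp
qed

text \<open>
  Here \<open>N\<close> collects the stages at which the greedy construction intersects with \<open>G\<^sub>n\<close>, and \<open>p\<close> bounds
  what is left of \<open>G\<^sub>n\<close> for the other \<open>n\<close>. It exists because countably many points of the long ray are
  bounded.
\<close>

lemma club_deciding_closed_sets:
  assumes "closed F" "\<not> bdd_above (proj ` F)" and G: "\<And>n. closed (G n)"
  obtains N :: "nat set" and p where "\<not> bdd_above (proj ` (F \<inter> \<Inter>(G ` N)))"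
    and "\<And>x n. x \<in> F \<inter> \<Inter>(G ` N) \<Longrightarrow> p < proj x \<Longrightarrow> x \<in> G n \<longleftrightarrow> n \<in> N"
proof -
  (* E J is the club reached after intersecting with the sets indexed by J, and D n is the set of
     the indices below n that the greedy construction accepts. *)
  define E where "E J = F \<inter> \<Inter>(G ` J)" for J
  define D where "D = rec_nat {} (\<lambda>n J. if bdd_above (proj ` E (insert n J)) then J else insert n J)"
  have D: "D 0 = {}"
    "\<And>n. D (Suc n) = (if bdd_above (proj ` E (insert n (D n))) then D n else insert n (D n))"
    by (simp_all add: D_def)
  define N where "N = (\<Union>n. D n)"
  have "\<not> bdd_above (proj ` E (D n))" for n
    by (induction n) (use assms(2) in \<open>auto simp: D E_def\<close>)
  moreover have "decseq (\<lambda>n. E (D n))"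
    by (rule decseq_SucI) (auto simp: D E_def)
  moreover have "closed (E (D n))" for n
    unfolding E_def using \<open>closed F\<close> G by auto
  ultimately have "\<not> bdd_above (proj ` (\<Inter>n. E (D n)))"
    by (intro unbounded_decreasing_INT)
  also have "(\<Inter>n. E (D n)) = E N"
    by (auto simp: E_def N_def)
  finally have unbounded: "\<not> bdd_above (proj ` E N)" .
  have "\<exists>p. \<forall>x\<in>E N. p < proj x \<longrightarrow> x \<notin> G n" if "n \<notin> N" for n
  proof -
    have "bdd_above (proj ` E (insert n (D n)))"
      using that D(2)[of n] unfolding N_def by (metis UN_iff UNIV_I insertI1)
    then obtain p where "\<And>x. x \<in> E (insert n (D n)) \<Longrightarrow> proj x \<le> p"
      by (auto simp: bdd_above_def)
    moreover have "x \<in> E (insert n (D n))" if "x \<in> E N" "x \<in> G n" for x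
      using that by (auto simp: E_def N_def)
    ultimately show ?thesis
      by (meson not_le)
  qed
  then obtain q where q: "\<And>n x. n \<notin> N \<Longrightarrow> x \<in> E N \<Longrightarrow> q n < proj x \<Longrightarrow> x \<notin> G n"
    by metis
  obtain \<delta> where \<delta>: "\<And>n. fst (Rep_long_ray (q n)) \<le> \<delta>"
    using countable_imp_bdd_above_omega1[of "range (\<lambda>n. fst (Rep_long_ray (q n)))"]
    by (auto simp: bdd_above_def)
  have above: "q n < ray_of (osuc \<delta>)" for n
    using le_less_trans[OF \<delta> less_osuc] by (rule less_ray_ofI)
  show thesis
  proof (rule that)
    show "\<not> bdd_above (proj ` (F \<inter> \<Inter>(G ` N)))"
      using unbounded by (simp add: E_def)
  next
    fix x n assume "x \<in> F \<inter> \<Inter>(G ` N)" "ray_of (osuc \<delta>) < proj x"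
    then show "x \<in> G n \<longleftrightarrow> n \<in> N"
      using q[of n x] less_trans[OF above] by (auto simp: E_def)
  qed
qed


lemma club_of_ordinals_met_by_club:
  assumes "closed E" and unbounded: "\<not> bdd_above (proj ` E)"
  shows "club_in_omega1 {\<alpha>. \<gamma> < \<alpha> \<and> ray_of \<alpha> \<in> proj ` E}" (is "club_in_omega1 ?C")
  unfolding club_in_omega1_def
proof (intro conjI)
  show "bot \<notin> ?C"
    using bot_less_omega1 by blast
  show "closed ?C"
  proof (rule closed_omega1_sequentiallyI)
    fix X \<alpha> assume X: "strict_mono X" "X \<longlonglongrightarrow> \<alpha>" "\<And>n. X n < \<alpha>" "\<And>n. X n \<in> ?C"
    have "\<exists>x. x \<in> E \<and> proj x = ray_of (X n)" for n
      using X(4)[of n] by auto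
    then obtain x where x: "\<And>n. x n \<in> E" "\<And>n. proj (x n) = ray_of (X n)"
      by metis
    have "ray_of (X n) \<le> ray_of \<alpha>" for n
    proof -
      have "bot < X n"
        using X(4)[of n] by (auto intro: bot_less_omega1)
      then show ?thesis
        using X(3)[of n] by (simp add: ray_of_le_iff bot_less_omega1)
    qed
    then have "(\<lambda>n. proj (x n)) \<longlonglongrightarrow> ray_of \<alpha>"
      unfolding x(2) by (intro tendsto_ray_of[OF X(2,3)]) auto
    then obtain y r where y: "strict_mono (r :: nat \<Rightarrow> nat)" "(x \<circ> r) \<longlonglongrightarrow> y" "proj y = ray_of \<alpha>"
      by (rule convergent_subsequence_over_limit)
    have "y \<in> E"
      using \<open>closed E\<close> _ _ y(2) by (rule Lim_in_closed_set) (auto simp: x)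
    moreover have "\<gamma> < \<alpha>"
      using X(3)[of 0] X(4)[of 0] by auto
    ultimately show "\<alpha> \<in> ?C"
      using y(3) by (auto intro: rev_image_eqI)
  qed
  show "\<not> bdd_above ?C"
  proof
    assume "bdd_above ?C"
    then obtain b where b: "\<And>\<alpha>. \<alpha> \<in> ?C \<Longrightarrow> \<alpha> \<le> b"
      by (auto simp: bdd_above_def)
    have "decseq (\<lambda>_::nat. E)"
      by (simp add: decseq_def)
    then obtain \<alpha> y where y: "max \<gamma> b < \<alpha>" "proj y = ray_of \<alpha>" "y \<in> E"
      using decreasing_clubs_meet_over_ordinal[of "\<lambda>_. E" "max \<gamma> b"] assms by metis
    then have "\<alpha> \<in> ?C"
      by (auto intro: rev_image_eqI)
    with b[of \<alpha>] y(1) show False by auto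
  qed
qed

text \<open>
  Both alternatives come from one construction of \<open>E\<close> and \<open>C\<close>, which makes the set \<open>A x\<close> of angles
  leading from \<open>x\<close> into \<open>F\<close> the same for all \<open>x \<in> E\<close> beyond \<open>p\<close>. Which alternative holds depends only on
  whether this common set is the whole circle.
\<close>

lemma club_dichotomy:
  assumes "club_in_bundle proj F"
  obtains C where "club_in_omega1 C" "proj -` (ray_of ` C) \<subseteq> F"
  | C n E where "club_in_omega1 C" "\<forall>\<alpha>\<in>C. \<not> proj -` {ray_of \<alpha>} \<subseteq> F"
      "E \<subseteq> F" "club_in_bundle proj E" "cyclic_over proj act C n E"
proof -
  have F: "closed F" "\<not> bdd_above (proj ` F)"
    using assms by (auto simp: club_in_bundle_def)
  define G where "G n = {x. \<exists>t\<in>rational_interval n. act x (angle t) \<in> F}" for n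
  define A where "A x = {\<theta>. act x \<theta> \<in> F}" for x
  have closed_G: "closed (G n)" for n
    unfolding G_def using F(1) compact_rational_interval by (rule closed_hitting_set)
  obtain N p where unbounded: "\<not> bdd_above (proj ` (F \<inter> \<Inter>(G ` N)))"
    and decided: "\<And>x n. x \<in> F \<inter> \<Inter>(G ` N) \<Longrightarrow> p < proj x \<Longrightarrow> x \<in> G n \<longleftrightarrow> n \<in> N"
    using club_deciding_closed_sets[OF F, of G] closed_G by blast
  define E where "E = F \<inter> \<Inter>(G ` N)"
  have "closed E"
    unfolding E_def using F(1) closed_G by auto
  have G_iff: "x \<in> G n \<longleftrightarrow> angle -` A x \<inter> rational_interval n \<noteq> {}" for x n
    by (auto simp: G_def A_def)
  have A_zero: "0 \<in> A x \<longleftrightarrow> x \<in> F" for x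
    by (simp add: A_def act_zero)
  have A_eq: "A x = A y" if "x \<in> E" "y \<in> E" "p < proj x" "p < proj y" for x y
  proof -
    have "angle -` A x = angle -` A y"
    proof (rule closed_eq_if_same_rational_intervals)
      show "closed (angle -` A x)" "closed (angle -` A y)"
        using closed_orbit_hits[OF F(1)] by (auto simp: A_def)
      show "angle -` A x \<inter> rational_interval n = {} \<longleftrightarrow> angle -` A y \<inter> rational_interval n = {}" for n
        using decided[of x n] decided[of y n] that G_iff[of x n] G_iff[of y n] unfolding E_def by blast
    qed
    then show ?thesis
      using angle_surj by (metis surj_def surj_image_vimage_eq)
  qed
  (* Membership in E is a condition on A x alone, which is why the fibres of E are full orbits of the
     stabiliser and not merely contained in them. *)
  have E_if_A_eq: "y \<in> E" if "x \<in> E" "A y = A x" for x y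
    using that A_zero[of x] A_zero[of y] G_iff by (auto simp: E_def)
  define C where "C = {\<alpha>. fst (Rep_long_ray p) < \<alpha> \<and> ray_of \<alpha> \<in> proj ` E}"
  have C: "club_in_omega1 C"
    unfolding C_def using \<open>closed E\<close> unbounded
    by (intro club_of_ordinals_met_by_club) (auto simp: E_def)
  have C_above: "p < ray_of \<alpha>" if "\<alpha> \<in> C" for \<alpha>
    using that less_ray_ofI by (auto simp: C_def)
  have "C \<noteq> {}"
    using C by (auto simp: club_in_omega1_def)
  then obtain x0 where x0: "x0 \<in> E" "p < proj x0"
    using C_above by (fastforce simp: C_def)
  (* The stabiliser of the common value A x0; shifting x by \<eta> shifts A x by -\<eta>. *)
  define H where "H = {\<eta>. \<forall>\<theta>. \<eta> + \<theta> \<in> A x0 \<longleftrightarrow> \<theta> \<in> A x0}"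
  have orbit: "act x \<eta> \<in> E \<longleftrightarrow> \<eta> \<in> H" if "x \<in> E" "p < proj x" for x \<eta>
  proof -
    have "act x \<eta> \<in> E \<longleftrightarrow> A (act x \<eta>) = A x0"
      using A_eq[of "act x \<eta>" x0] E_if_A_eq[OF x0(1)] x0 that(2) by (auto simp: proj_act)
    also have "A (act x \<eta>) = {\<theta>. \<eta> + \<theta> \<in> A x0}"
      using A_eq[OF that(1) x0(1) that(2) x0(2)] by (auto simp: A_def act_add)
    finally show ?thesis
      by (auto simp: H_def)
  qed
  show thesis
  proof (cases "A x0 = UNIV")
    case True
    have "proj -` (ray_of ` C) \<subseteq> F"
    proof
      fix z assume "z \<in> proj -` (ray_of ` C)"
      then obtain \<alpha> where \<alpha>: "\<alpha> \<in> C" "proj z = ray_of \<alpha>"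
        by auto
      then obtain x where x: "x \<in> E" "proj x = proj z"
        by (auto simp: C_def)
      then obtain \<theta> where "act x \<theta> = z"
        using act_transitive by blast
      moreover have "A x = UNIV"
        using A_eq[OF x(1) x0(1) _ x0(2)] x(2) \<alpha> C_above True by simp
      ultimately show "z \<in> F"
        by (auto simp: A_def)
    qed
    with C show thesis by (rule that(1))
  next
    case False
    have not_full: "\<not> proj -` {ray_of \<alpha>} \<subseteq> F" if "\<alpha> \<in> C" for \<alpha>
    proof
      assume sub: "proj -` {ray_of \<alpha>} \<subseteq> F"
      obtain x where x: "x \<in> E" "proj x = ray_of \<alpha>"
        using \<open>\<alpha> \<in> C\<close> by (auto simp: C_def)
      then have "A x = UNIV"
        using sub by (auto simp: A_def proj_act)
      with False A_eq[OF x(1) x0(1) _ x0(2)] x(2) C_above[OF that] show False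
        by simp
    qed
    have "H \<noteq> UNIV"
    proof
      assume "H = UNIV"
      have "0 \<in> A x0"
        using x0(1) by (simp add: A_zero E_def)
      then have "\<eta> \<in> A x0" for \<eta>
        using \<open>H = UNIV\<close> by (metis (mono_tags, lifting) H_def UNIV_I add.right_neutral mem_Collect_eq)
      with False show False by auto
    qed
    have "closed H"
    proof -
      (* H is the preimage of the closed set E under the orbit map of x0. *)
      have "angle -` H = {t. act x0 (angle t) \<in> E}"
        using orbit[OF x0] by auto
      then have "closed (angle -` H)"
        using closed_orbit_hits[OF \<open>closed E\<close>] by simp
      then show ?thesis
        by (simp add: closed_def open_circle_def vimage_Compl)
    qed
    have "0 \<in> H"
      by (simp add: H_def)
    have diff: "\<theta> - \<eta> \<in> H" if "\<theta> \<in> H" "\<eta> \<in> H" for \<theta> \<eta>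
      unfolding H_def
    proof (intro CollectI allI)
      fix \<zeta>
      have "\<theta> - \<eta> + \<zeta> \<in> A x0 \<longleftrightarrow> \<theta> + (\<zeta> - \<eta>) \<in> A x0"
        by (simp add: algebra_simps)
      also have "\<dots> \<longleftrightarrow> \<zeta> - \<eta> \<in> A x0"
        using that(1) by (simp add: H_def)
      also have "\<dots> \<longleftrightarrow> \<eta> + (\<zeta> - \<eta>) \<in> A x0"
        using that(2) by (simp only: H_def mem_Collect_eq)
      finally show "\<theta> - \<eta> + \<zeta> \<in> A x0 \<longleftrightarrow> \<zeta> \<in> A x0"
        by simp
    qed
    obtain n where n: "card H = n" "finite H"
      "H = {angle (2 * pi * real k / real n) | k. k < n}"
      using closed_subgroup_circle_cases[OF \<open>closed H\<close> \<open>0 \<in> H\<close> diff] \<open>H \<noteq> UNIV\<close> by blast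
    have fibre: "proj -` {ray_of \<alpha>} \<inter> E = act x ` H"
      if "\<alpha> \<in> C" "x \<in> E" "proj x = ray_of \<alpha>" for \<alpha> x
    proof -
      have iff: "act x \<eta> \<in> E \<longleftrightarrow> \<eta> \<in> H" for \<eta>
        using orbit[OF that(2)] that(3) C_above[OF that(1)] by simp
      have "\<exists>\<eta>. y = act x \<eta>" if "proj y = ray_of \<alpha>" for y
        using act_transitive[of x y] that \<open>proj x = ray_of \<alpha>\<close> by auto
      then show ?thesis
        using iff \<open>proj x = ray_of \<alpha>\<close> by (auto simp: proj_act)
    qed
    have "cyclic_over proj act C n E"
      unfolding cyclic_over_def
    proof (intro ballI conjI)
      fix \<alpha> assume "\<alpha> \<in> C"
      then obtain x where x: "x \<in> E" "proj x = ray_of \<alpha>"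
        by (auto simp: C_def)
      have *: "E \<inter> proj -` {ray_of \<alpha>} = act x ` H"
        using fibre[OF \<open>\<alpha> \<in> C\<close> x] by blast
      show "finite (E \<inter> proj -` {ray_of \<alpha>})"
        unfolding * using n(2) by simp
      show "card (E \<inter> proj -` {ray_of \<alpha>}) = n"
        unfolding * using n(1) by (subst card_image) (auto simp: inj_on_def act_inject)
    next
      fix \<alpha> x assume "\<alpha> \<in> C" "x \<in> proj -` {ray_of \<alpha>} \<inter> E"
      then have "proj -` {ray_of \<alpha>} \<inter> E = act x ` H"
        by (intro fibre) auto
      also have "\<dots> = {act x (angle (2 * pi * real k / real n)) | k. k < n}"
        unfolding n(3) by blast
      finally show "proj -` {ray_of \<alpha>} \<inter> E = {act x (angle (2 * pi * real k / real n)) | k. k < n}" .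
    qed
    moreover have "club_in_bundle proj E" "E \<subseteq> F"
      using \<open>closed E\<close> unbounded by (auto simp: club_in_bundle_def E_def)
    ultimately show thesis
      using not_full that(2)[OF C] by blast
  qed
qed

end


section \<open>The dichotomy for club sets\<close>

theorem theorem2p4:
  fixes proj :: "'m::topological_space \<Rightarrow> long_ray"
    and act :: "'m \<Rightarrow> circle \<Rightarrow> 'm"
    and f :: "omega1 \<Rightarrow> long_ray \<times> circle \<Rightarrow> 'm"
    and F :: "'m set"
  assumes principal: "principal_circle_bundle proj act"
    and f_homeo: "\<And>\<alpha>. \<exists>g. homeomorphism ({..<ray_of (osuc \<alpha>)} \<times> UNIV)
                  (proj -` {..<ray_of (osuc \<alpha>)}) (f \<alpha>) g"
    and f_fibre: "\<And>\<alpha> p \<phi>. p < ray_of (osuc \<alpha>) \<Longrightarrow> proj (f \<alpha> (p, \<phi>)) = p"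
    and F_club: "club_in_bundle proj F"
  shows "\<exists>C. club_in_omega1 C \<and>
    (proj -` (ray_of ` C) \<subseteq> F) \<noteq>
    ((\<forall>\<alpha>\<in>C. \<not> proj -` {ray_of \<alpha>} \<subseteq> F) \<and>
     (\<exists>(n::nat) E. E \<subseteq> F \<and> club_in_bundle proj E \<and> cyclic_over proj act C n E))"
proof -
  interpret principal_circle_bundle proj act
    by (rule principal)
  (* Only that clubs are nonempty: the alternatives contradict each other over any point of C. *)
  have exclusive: "\<not> (\<forall>\<alpha>\<in>C. \<not> proj -` {ray_of \<alpha>} \<subseteq> F)"
    if "club_in_omega1 C" "proj -` (ray_of ` C) \<subseteq> F" for C
  proof -
    obtain \<alpha> where "\<alpha> \<in> C"
      using \<open>club_in_omega1 C\<close> by (fastforce simp: club_in_omega1_def)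
    with that(2) show ?thesis by blast
  qed
  from F_club show ?thesis
  proof (cases rule: club_dichotomy)
    case (1 C)
    with exclusive[of C] show ?thesis by blast
  next
    case (2 C n E)
    with exclusive[of C] show ?thesis by blast
  qed
qed

end
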